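(* Let $\eta_0\in[1,2]$. Then, for every $x,y\in\mathbb{R}^n$, $$\lim_{\eta\to\eta_0}d_{V,\eta}(x,y)=d_{V,\eta_0}(x,y),$$ where $\eta$ ranges in $[1,2]$.
   Context: Setting: $V$ and $W$ are distributions of $k$-planes and $(n-k)$-planes in $\mathbb{R}^n$, spanned at every point by smooth vector fields $X_1,\dots,X_k$ and $X_{k+1},\dots,X_n$ respectively, with $\mathbb{R}^n=V(x)\oplus W(x)$ for every $x$. $\Pi^V_x$ is the projection onto $V(x)$ along $W(x)$ and $\Pi^W_x:=\mathrm{id}-\Pi^V_x$. For a Lipschitz curve $\gamma:[0,1]\to\mathbb{R}^n$ and $t\in[0,1]$ the derived set is $$\mathcal{D}\gamma(t):=\bigcap_{r>0}\overline{\Big\{\tfrac{\gamma(a)-\gamma(b)}{a-b}:\ a<b,\ a,b\in[0,1],\ |a-t|+|b-t|\le r\Big\}}.$$ For $\eta\in[1,2]$ let $\ell_\eta(\gamma):=\sup_{t\in[0,1]}\max_{v\in\mathcal{D}\gamma(t)}\big(|\Pi^V_{\gamma(t)}[v]|+|\Pi^W_{\gamma(t)}[v]|^{1/\eta}\big)$ and $$d_{V,\eta}(x,y):=\inf\{\ell_\eta(\gamma):\gamma\in\mathrm{Lip}([0,1],\mathbb{R}^n),\ \gamma(0)=x,\ \gamma(1)=y\}.$$ *)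

theory Defs
  imports "HOL-Analysis.Analysis"
begin

fun Ck_map :: "nat \<Rightarrow> ('a::real_normed_vector \<Rightarrow> 'b::real_normed_vector) \<Rightarrow> bool" where
  "Ck_map 0 f \<longleftrightarrow> continuous_on UNIV f"
| "Ck_map (Suc m) f \<longleftrightarrow>
     (\<forall>x. f differentiable (at x)) \<and> (\<forall>v. Ck_map m (\<lambda>x. frechet_derivative f (at x) v))"

definition smooth_map :: "('a::real_normed_vector \<Rightarrow> 'b::real_normed_vector) \<Rightarrow> bool" where
  "smooth_map f \<longleftrightarrow> (\<forall>m. Ck_map m f)"

definition plane_distribution :: "nat \<Rightarrow> ('a::euclidean_space \<Rightarrow> 'a set) \<Rightarrow> bool" where
  "plane_distribution k V \<longleftrightarrow> (\<forall>x. subspace (V x) \<and> dim (V x) = k)"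

definition direct_sum_decomp :: "'a::real_vector set \<Rightarrow> 'a set \<Rightarrow> bool" where
  "direct_sum_decomp A B \<longleftrightarrow>
     subspace A \<and> subspace B \<and> A \<inter> B = {0} \<and> {a + b | a b. a \<in> A \<and> b \<in> B} = UNIV"

text \<open>Meaningful only when the whole space is the direct sum of \<open>A\<close> and \<open>B\<close>.\<close>
definition proj_along :: "'a::real_vector set \<Rightarrow> 'a set \<Rightarrow> 'a \<Rightarrow> 'a" where
  "proj_along A B v = (THE p. p \<in> A \<and> v - p \<in> B)"

text \<open>Curves are total functions on the reals, of which only the restriction to \<open>{0..1}\<close> matters.\<close>
definition lipschitz_curve :: "(real \<Rightarrow> 'a::metric_space) \<Rightarrow> bool" where
  "lipschitz_curve \<gamma> \<longleftrightarrow> (\<exists>L. L-lipschitz_on {0..1} \<gamma>)"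

definition derived_set :: "(real \<Rightarrow> 'a::real_normed_vector) \<Rightarrow> real \<Rightarrow> 'a set" where
  "derived_set \<gamma> t = (\<Inter>r\<in>{0<..}. closure {(\<gamma> a - \<gamma> b) /\<^sub>R (a - b) | a b.
      a < b \<and> a \<in> {0..1} \<and> b \<in> {0..1} \<and> \<bar>a - t\<bar> + \<bar>b - t\<bar> \<le> r})"

definition speed :: "('a::euclidean_space \<Rightarrow> 'a set) \<Rightarrow> ('a \<Rightarrow> 'a set) \<Rightarrow> real \<Rightarrow> 'a \<Rightarrow> 'a \<Rightarrow> real" where
  "speed V W \<eta> x v =
     norm (proj_along (V x) (W x) v) + norm (v - proj_along (V x) (W x) v) powr (1 / \<eta>)"

text \<open>For a Lipschitz curve the derived set is nonempty and compact and, for continuous complementary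
  distributions, \<open>speed V W \<eta> (\<gamma> t)\<close> is continuous; so the inner supremum is a maximum and
  both real-valued suprema are over nonempty bounded sets.\<close>
definition curve_length ::
    "('a::euclidean_space \<Rightarrow> 'a set) \<Rightarrow> ('a \<Rightarrow> 'a set) \<Rightarrow> real \<Rightarrow> (real \<Rightarrow> 'a) \<Rightarrow> real" where
  "curve_length V W \<eta> \<gamma> =
     (SUP t\<in>{0..1}. SUP v\<in>derived_set \<gamma> t. speed V W \<eta> (\<gamma> t) v)"

definition dist_V ::
    "('a::euclidean_space \<Rightarrow> 'a set) \<Rightarrow> ('a \<Rightarrow> 'a set) \<Rightarrow> real \<Rightarrow> 'a \<Rightarrow> 'a \<Rightarrow> real" where
  "dist_V V W \<eta> x y =
     (INF \<gamma>\<in>{\<gamma>. lipschitz_curve \<gamma> \<and> \<gamma> 0 = x \<and> \<gamma> 1 = y}. curve_length V W \<eta> \<gamma>)"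

end

theory Submission
  imports Defs
begin

text \<open>
  Changing \<open>\<eta>\<close> only changes the exponent put on the \<open>W\<close>-component \<open>s = |\<Pi>\<^sup>W[v]|\<close> of a
  velocity. Two exponents \<open>1/\<eta>\<^sub>1\<close> and \<open>1/\<eta>\<^sub>2\<close> that are close give values \<open>s\<^bsup>1/\<eta>\<^sub>1\<^esup>\<close> and
  \<open>s\<^bsup>1/\<eta>\<^sub>2\<^esup>\<close> that are close, uniformly for \<open>s\<close> in a bounded interval
  (\<open>powr_inverse_exponent_uniform\<close>). The restriction to bounded \<open>s\<close> is harmless: a curve of
  \<open>\<eta>\<close>-length at most \<open>C \<ge> 1\<close> has \<open>s \<le> C\<^bsup>\<eta>\<^esup> \<le> C\<^sup>2\<close> along all its derived vectors, and this bound
  is the same for all \<open>\<eta>\<close> in \<open>[1,2]\<close>. Hence the two lengths of the same curve differ by at most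
  \<open>\<epsilon>\<close> as soon as one of them is at most \<open>C\<close>, and the infima differ by at most \<open>\<epsilon>\<close> as well
  (\<open>dist_V_le_add\<close>). The comparison is made curve by curve, so that no limit of almost
  minimizing curves has to be extracted.

  What remains is to see that the suprema in the length are taken over nonempty bounded sets. The
  derived set is a decreasing intersection of nonempty compact sets. The speed is bounded along
  a curve because the projections are bounded on compact sets: by compactness, the coordinates of
  \<open>v\<close> in the frame \<open>X\<^sub>1(p), \<dots>, X\<^sub>n(p)\<close> are controlled by \<open>|v|\<close> uniformly for \<open>p\<close> in a
  compact set (\<open>frame_coordinates_bounded\<close>).
\<close>

section \<open>Derived sets of Lipschitz curves\<close>

lemma difference_quotient_norm_le:
  fixes \<gamma> :: "real \<Rightarrow> 'a::real_normed_vector"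
  assumes "L-lipschitz_on {0..1} \<gamma>" "a \<in> {0..1}" "b \<in> {0..1}" "a < b"
  shows "norm ((\<gamma> a - \<gamma> b) /\<^sub>R (a - b)) \<le> L"
proof -
  have "norm (\<gamma> a - \<gamma> b) \<le> L * \<bar>a - b\<bar>"
    using lipschitz_onD[OF assms(1-3)] by (simp add: dist_norm)
  then show ?thesis
    unfolding norm_scaleR using assms(4) by (simp add: abs_if field_simps)
qed

lemma derived_set_norm_le:
  fixes \<gamma> :: "real \<Rightarrow> 'a::real_normed_vector"
  assumes "L-lipschitz_on {0..1} \<gamma>" "v \<in> derived_set \<gamma> t"
  shows "norm v \<le> L"
proof -
  let ?Q = "{(\<gamma> a - \<gamma> b) /\<^sub>R (a - b) | a b.
      a < b \<and> a \<in> {0..1} \<and> b \<in> {0..1} \<and> \<bar>a - t\<bar> + \<bar>b - t\<bar> \<le> 1}"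
  have "v \<in> closure ?Q"
    using assms(2) unfolding derived_set_def by (rule INT_D) simp
  moreover have "?Q \<subseteq> cball 0 L"
    using difference_quotient_norm_le[OF assms(1)] by auto
  ultimately have "v \<in> cball 0 L"
    using closure_minimal[of ?Q "cball 0 L"] closed_cball by blast
  then show ?thesis by simp
qed

text \<open>
  For a Lipschitz curve the chord slopes near \<open>t\<close> stay in a fixed ball, so their closures form
  a decreasing family of nonempty compact sets.
\<close>
lemma derived_set_nonempty:
  fixes \<gamma> :: "real \<Rightarrow> 'a::euclidean_space"
  assumes "lipschitz_curve \<gamma>" "t \<in> {0..1}"
  shows "derived_set \<gamma> t \<noteq> {}"
proof -
  obtain L where L: "L-lipschitz_on {0..1} \<gamma>"
    using assms(1) unfolding lipschitz_curve_def by blast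
  define Q where "Q r = {(\<gamma> a - \<gamma> b) /\<^sub>R (a - b) | a b.
      a < b \<and> a \<in> {0..1} \<and> b \<in> {0..1} \<and> \<bar>a - t\<bar> + \<bar>b - t\<bar> \<le> r}" for r
  have Q_mono: "Q r \<subseteq> Q s" if "r \<le> s" for r s
    using that unfolding Q_def by fastforce
  have Q_nonempty: "Q r \<noteq> {}" if "r > 0" for r
  proof -
    \<comment> \<open>One endpoint of the chord is \<open>t\<close>; the other one lies on the side of \<open>t\<close> on which there is
      room inside \<open>[0,1]\<close>.\<close>
    define h where "h = min r (1/2)"
    have h: "0 < h" "h \<le> r" "h \<le> 1/2" using that by (auto simp: h_def)
    define a where "a = (if t \<le> 1/2 then t else t - h)"
    have "a < a + h \<and> a \<in> {0..1} \<and> a + h \<in> {0..1} \<and> \<bar>a - t\<bar> + \<bar>a + h - t\<bar> \<le> r"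
      using h assms(2) by (auto simp: a_def)
    then show ?thesis unfolding Q_def by blast
  qed
  have Q_bounded: "closure (Q r) \<subseteq> cball 0 L" for r
    unfolding Q_def
    using difference_quotient_norm_le[OF L] by (intro closure_minimal) auto
  have "(\<Inter>n::nat. closure (Q (1 / real (Suc n)))) \<noteq> {}"
  proof (rule bounded_closed_nest[where S = "\<lambda>n. closure (Q (1 / real (Suc n)))", THEN exE])
    show "closure (Q (1 / real (Suc n))) \<noteq> {}" for n
      using Q_nonempty by simp
    show "closure (Q (1 / real (Suc n))) \<subseteq> closure (Q (1 / real (Suc m)))" if "m \<le> n" for m n
      using that by (intro closure_mono Q_mono) (simp add: field_simps)
    show "bounded (closure (Q (1 / real (Suc 0))))"
      using bounded_cball Q_bounded by (rule bounded_subset)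
  qed auto
  then obtain v where v: "v \<in> closure (Q (1 / real (Suc n)))" for n
    by blast
  have "v \<in> closure (Q r)" if "r > 0" for r
  proof -
    obtain n where "1 / real (Suc n) < r"
      using nat_approx_posE[OF \<open>r > 0\<close>] by blast
    then show ?thesis
      using v[of n] closure_mono[OF Q_mono[of "1 / real (Suc n)" r]] by auto
  qed
  then have "v \<in> derived_set \<gamma> t"
    unfolding derived_set_def Q_def by blast
  then show ?thesis by blast
qed

section \<open>Length of curves for projections bounded on compact sets\<close>

text \<open>
  Continuity of the splitting enters the argument only through this bound, which keeps the speed
  finite along a curve.
\<close>
locale locally_bounded_splitting =
  fixes V W :: "'a::euclidean_space \<Rightarrow> 'a set"
  assumes proj_bounded_on_compact:
    "compact K \<Longrightarrow> \<exists>B\<ge>0. \<forall>p\<in>K. \<forall>v. norm (proj_along (V p) (W p) v) \<le> B * norm v"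
begin

lemma speed_nonneg: "0 \<le> speed V W \<eta> p v"
  by (simp add: speed_def)

lemma speed_bounded_along_curve:
  assumes "lipschitz_curve \<gamma>" "\<eta> > 0"
  obtains M where "\<And>t v. t \<in> {0..1} \<Longrightarrow> v \<in> derived_set \<gamma> t \<Longrightarrow> speed V W \<eta> (\<gamma> t) v \<le> M"
proof -
  obtain L where L: "L-lipschitz_on {0..1} \<gamma>"
    using assms(1) unfolding lipschitz_curve_def by blast
  have "compact (\<gamma> ` {0..1})"
    using lipschitz_on_continuous_on[OF L] by (intro compact_continuous_image) auto
  from proj_bounded_on_compact[OF this] obtain B where B: "B \<ge> 0"
    "\<forall>p\<in>\<gamma> ` {0..1}. \<forall>v. norm (proj_along (V p) (W p) v) \<le> B * norm v"
    by (elim exE conjE)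
  have "speed V W \<eta> (\<gamma> t) v \<le> B * L + (L + B * L) powr (1 / \<eta>)"
    if t: "t \<in> {0..1}" and v: "v \<in> derived_set \<gamma> t" for t v
  proof -
    have vL: "norm v \<le> L" using derived_set_norm_le[OF L v] .
    have "norm (proj_along (V (\<gamma> t)) (W (\<gamma> t)) v) \<le> B * norm v"
      using B(2) t by blast
    also have "\<dots> \<le> B * L" using vL B(1) by (rule mult_left_mono)
    finally have P: "norm (proj_along (V (\<gamma> t)) (W (\<gamma> t)) v) \<le> B * L" .
    then have "norm (v - proj_along (V (\<gamma> t)) (W (\<gamma> t)) v) \<le> L + B * L"
      using vL norm_triangle_ineq4[of v "proj_along (V (\<gamma> t)) (W (\<gamma> t)) v"] by linarith
    then show ?thesis
      using P assms(2) unfolding speed_def by (intro add_mono powr_mono2) auto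
  qed
  then show ?thesis by (rule that)
qed

lemma curve_length_le:
  assumes "lipschitz_curve \<gamma>"
    and "\<And>t v. t \<in> {0..1} \<Longrightarrow> v \<in> derived_set \<gamma> t \<Longrightarrow> speed V W \<eta> (\<gamma> t) v \<le> M"
  shows "curve_length V W \<eta> \<gamma> \<le> M"
  unfolding curve_length_def
proof (rule cSUP_least)
  show "(SUP v\<in>derived_set \<gamma> t. speed V W \<eta> (\<gamma> t) v) \<le> M" if "t \<in> {0..1}" for t
    using derived_set_nonempty[OF assms(1) that] assms(2)[OF that] by (rule cSUP_least)
qed simp

lemma speed_le_curve_length:
  assumes "lipschitz_curve \<gamma>" "\<eta> > 0" "t \<in> {0..1}" "v \<in> derived_set \<gamma> t"
  shows "speed V W \<eta> (\<gamma> t) v \<le> curve_length V W \<eta> \<gamma>"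
proof -
  obtain M where M: "\<And>t v. t \<in> {0..1} \<Longrightarrow> v \<in> derived_set \<gamma> t \<Longrightarrow> speed V W \<eta> (\<gamma> t) v \<le> M"
    using speed_bounded_along_curve[OF assms(1,2)] by blast
  have "speed V W \<eta> (\<gamma> t) v \<le> (SUP v\<in>derived_set \<gamma> t. speed V W \<eta> (\<gamma> t) v)"
    using M[OF assms(3)] assms(4) by (intro cSUP_upper bdd_aboveI2)
  also have "\<dots> \<le> curve_length V W \<eta> \<gamma>"
    unfolding curve_length_def
  proof (rule cSUP_upper[OF assms(3)], rule bdd_aboveI2)
    show "(SUP v\<in>derived_set \<gamma> s. speed V W \<eta> (\<gamma> s) v) \<le> M" if "s \<in> {0..1}" for s
      using derived_set_nonempty[OF assms(1) that] M[OF that] by (intro cSUP_least)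
  qed
  finally show ?thesis .
qed

lemma curve_length_nonneg:
  assumes "lipschitz_curve \<gamma>" "\<eta> > 0"
  shows "0 \<le> curve_length V W \<eta> \<gamma>"
proof -
  have "(0::real) \<in> {0..1}" by simp
  moreover from derived_set_nonempty[OF assms(1) this] obtain v where "v \<in> derived_set \<gamma> 0"
    by blast
  ultimately have "speed V W \<eta> (\<gamma> 0) v \<le> curve_length V W \<eta> \<gamma>"
    by (rule speed_le_curve_length[OF assms])
  with speed_nonneg show ?thesis by (rule order_trans)
qed

lemma ex_lipschitz_curve:
  fixes x y :: 'a
  shows "\<exists>\<gamma>. lipschitz_curve \<gamma> \<and> \<gamma> 0 = x \<and> \<gamma> 1 = y"
proof (intro exI conjI)
  have "(norm (y - x))-lipschitz_on {0..1} (\<lambda>t. x + t *\<^sub>R (y - x))"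
    by (intro lipschitz_onI)
       (simp_all add: dist_norm mult.commute flip: scaleR_left_diff_distrib)
  then show "lipschitz_curve (\<lambda>t. x + t *\<^sub>R (y - x))"
    unfolding lipschitz_curve_def by blast
qed auto

lemma dist_V_le_curve_length:
  assumes "lipschitz_curve \<gamma>" "\<gamma> 0 = x" "\<gamma> 1 = y" "\<eta> > 0"
  shows "dist_V V W \<eta> x y \<le> curve_length V W \<eta> \<gamma>"
  unfolding dist_V_def
  by (rule cINF_lower, rule bdd_belowI2[where m = 0])
     (use assms curve_length_nonneg in auto)

lemma dist_V_less_imp_curve:
  assumes "dist_V V W \<eta> x y < c"
  obtains \<gamma> where "lipschitz_curve \<gamma>" "\<gamma> 0 = x" "\<gamma> 1 = y" "curve_length V W \<eta> \<gamma> < c"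
proof -
  have "curve_length V W \<eta> ` {\<gamma>. lipschitz_curve \<gamma> \<and> \<gamma> 0 = x \<and> \<gamma> 1 = y} \<noteq> {}"
    using ex_lipschitz_curve by blast
  from cInf_lessD[OF this, of c] assms show ?thesis
    unfolding dist_V_def by (auto intro: that)
qed

lemma dist_V_nonneg:
  assumes "\<eta> > 0"
  shows "0 \<le> dist_V V W \<eta> x y"
  unfolding dist_V_def
  using ex_lipschitz_curve curve_length_nonneg assms by (intro cINF_greatest) blast+

section \<open>Comparison of two exponents\<close>

lemma curve_length_le_add:
  assumes \<gamma>: "lipschitz_curve \<gamma>"
    and \<eta>1: "\<eta>1 \<in> {1..2}"
    and C: "1 \<le> C" "curve_length V W \<eta>1 \<gamma> \<le> C"
    and close: "\<And>s. s \<in> {0..C\<^sup>2} \<Longrightarrow> s powr (1 / \<eta>2) \<le> s powr (1 / \<eta>1) + \<epsilon>"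
  shows "curve_length V W \<eta>2 \<gamma> \<le> curve_length V W \<eta>1 \<gamma> + \<epsilon>"
proof (rule curve_length_le[OF \<gamma>])
  fix t v assume tv: "t \<in> {0..1::real}" "v \<in> derived_set \<gamma> t"
  define P where "P = proj_along (V (\<gamma> t)) (W (\<gamma> t)) v"
  define s where "s = norm (v - P)"
  have speed: "speed V W \<eta> (\<gamma> t) v = norm P + s powr (1 / \<eta>)" for \<eta>
    by (simp add: speed_def P_def s_def)
  have le: "speed V W \<eta>1 (\<gamma> t) v \<le> curve_length V W \<eta>1 \<gamma>"
    using speed_le_curve_length[OF \<gamma> _ tv] \<eta>1 by simp
  then have "s powr (1 / \<eta>1) \<le> C"
    using C(2) norm_ge_zero[of P] unfolding speed by linarith
  then have "(s powr (1 / \<eta>1)) powr \<eta>1 \<le> C powr \<eta>1"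
    using \<eta>1 by (intro powr_mono2) auto
  also have "\<dots> \<le> C powr 2"
    using C(1) \<eta>1 by (intro powr_mono) auto
  finally have "s \<le> C\<^sup>2"
    using \<eta>1 C(1) by (simp add: powr_powr s_def)
  then have "s powr (1 / \<eta>2) \<le> s powr (1 / \<eta>1) + \<epsilon>"
    by (intro close) (simp add: s_def)
  then show "speed V W \<eta>2 (\<gamma> t) v \<le> curve_length V W \<eta>1 \<gamma> + \<epsilon>"
    using le unfolding speed by linarith
qed

text \<open>
  The constant \<open>C\<close> bounds the length of the competing curves and, through \<open>C\<^sup>2\<close>, the range of
  \<open>s\<close> on which the two exponents have to be compared.
\<close>
lemma dist_V_le_add:
  assumes "\<eta>1 \<in> {1..2}" "\<eta>2 > 0" "1 \<le> C" "dist_V V W \<eta>1 x y < C"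
    and close: "\<And>s. s \<in> {0..C\<^sup>2} \<Longrightarrow> s powr (1 / \<eta>2) \<le> s powr (1 / \<eta>1) + \<epsilon>"
  shows "dist_V V W \<eta>2 x y \<le> dist_V V W \<eta>1 x y + \<epsilon>"
proof -
  have "dist_V V W \<eta>2 x y - \<epsilon> \<le> dist_V V W \<eta>1 x y"
  proof (rule dense_ge_bounded[OF assms(4)])
    fix z assume z: "dist_V V W \<eta>1 x y < z" "z < C"
    obtain \<gamma> where \<gamma>: "lipschitz_curve \<gamma>" "\<gamma> 0 = x" "\<gamma> 1 = y" "curve_length V W \<eta>1 \<gamma> < z"
      using dist_V_less_imp_curve[OF z(1)] by blast
    have "dist_V V W \<eta>2 x y \<le> curve_length V W \<eta>2 \<gamma>"
      by (rule dist_V_le_curve_length[OF \<gamma>(1-3) assms(2)])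
    also have "\<dots> \<le> curve_length V W \<eta>1 \<gamma> + \<epsilon>"
      using \<gamma>(4) z(2) by (intro curve_length_le_add[OF \<gamma>(1) assms(1,3) _ close]) auto
    finally show "dist_V V W \<eta>2 x y - \<epsilon> \<le> z"
      using \<gamma>(4) by linarith
  qed
  then show ?thesis by linarith
qed

end

lemma powr_inverse_exponent_uniform:
  fixes \<eta>0 M \<epsilon> :: real
  assumes "\<eta>0 \<in> {1..2}" "\<epsilon> > 0"
  shows "\<forall>\<^sub>F \<eta> in at \<eta>0 within {1..2}.
           \<forall>s\<in>{0..M}. \<bar>s powr (1 / \<eta>) - s powr (1 / \<eta>0)\<bar> < \<epsilon>"
proof -
  let ?f = "\<lambda>(\<eta>, s). s powr (1 / \<eta>) :: real"
  let ?K = "{1..2} \<times> {0..M}"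
  have "continuous_on ?K ?f"
    unfolding case_prod_beta by (intro continuous_on_powr' continuous_intros) auto
  then have "uniformly_continuous_on ?K ?f"
    by (rule compact_uniformly_continuous) (intro compact_Times compact_Icc)
  then obtain d where d: "d > 0"
    "\<And>z w. z \<in> ?K \<Longrightarrow> w \<in> ?K \<Longrightarrow> dist w z < d \<Longrightarrow> dist (?f w) (?f z) < \<epsilon>"
    using assms(2) unfolding uniformly_continuous_on_def by metis
  have "\<forall>s\<in>{0..M}. \<bar>s powr (1 / \<eta>) - s powr (1 / \<eta>0)\<bar> < \<epsilon>"
    if "\<eta> \<in> {1..2}" "dist \<eta> \<eta>0 < d" for \<eta>
    using d(2)[of "(\<eta>0, _)" "(\<eta>, _)"] that assms(1) by (auto simp: dist_Pair_Pair dist_real_def)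
  then show ?thesis
    unfolding eventually_at using d(1) by blast
qed

context locally_bounded_splitting
begin

theorem dist_V_tendsto:
  assumes "\<eta>0 \<in> {1..2}"
  shows "((\<lambda>\<eta>. dist_V V W \<eta> x y) \<longlongrightarrow> dist_V V W \<eta>0 x y) (at \<eta>0 within {1..2})"
proof (rule tendstoI)
  fix e :: real assume "e > 0"
  define \<epsilon> where "\<epsilon> = min (e / 2) 1"
  have \<epsilon>: "0 < \<epsilon>" "\<epsilon> < e" "\<epsilon> \<le> 1" using \<open>e > 0\<close> by (auto simp: \<epsilon>_def)
  \<comment> \<open>The first comparison gives \<open>d\<^bsub>\<eta>\<^esub> \<le> d\<^bsub>\<eta>0\<^esub> + 1\<close>, which is still below \<open>C\<close>, so that the
    reverse comparison can use the same \<open>C\<close>.\<close>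
  define C where "C = dist_V V W \<eta>0 x y + 2"
  have C: "1 \<le> C" using dist_V_nonneg[of \<eta>0 x y] assms by (simp add: C_def)
  have "\<forall>\<^sub>F \<eta> in at \<eta>0 within {1..2}. \<eta> \<in> {1..2}"
    by (simp add: eventually_at_filter)
  with powr_inverse_exponent_uniform[OF assms \<epsilon>(1), of "C\<^sup>2"]
  show "\<forall>\<^sub>F \<eta> in at \<eta>0 within {1..2}. dist (dist_V V W \<eta> x y) (dist_V V W \<eta>0 x y) < e"
  proof eventually_elim
    case (elim \<eta>)
    have up: "dist_V V W \<eta> x y \<le> dist_V V W \<eta>0 x y + \<epsilon>"
    proof (rule dist_V_le_add[OF assms _ C])
      show "s powr (1 / \<eta>) \<le> s powr (1 / \<eta>0) + \<epsilon>" if "s \<in> {0..C\<^sup>2}" for s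
        using bspec[OF elim(1) that] by linarith
    qed (use elim(2) in \<open>auto simp: C_def\<close>)
    have "dist_V V W \<eta>0 x y \<le> dist_V V W \<eta> x y + \<epsilon>"
    proof (rule dist_V_le_add[OF elim(2) _ C])
      show "dist_V V W \<eta> x y < C" using up \<epsilon>(3) by (simp add: C_def)
      show "s powr (1 / \<eta>0) \<le> s powr (1 / \<eta>) + \<epsilon>" if "s \<in> {0..C\<^sup>2}" for s
        using bspec[OF elim(1) that] by linarith
    qed (use assms in auto)
    with up \<epsilon>(2) show ?case by (simp add: dist_real_def)
  qed
qed

end

section \<open>Projections along distributions spanned by continuous frames\<close>

lemma proj_along_eqI:
  assumes "direct_sum_decomp A B" "a \<in> A" "v - a \<in> B"
  shows "proj_along A B v = a"
  unfolding proj_along_def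
proof (rule the_equality)
  fix p assume p: "p \<in> A \<and> v - p \<in> B"
  have "p - a \<in> A" "(v - a) - (v - p) \<in> B"
    using assms p unfolding direct_sum_decomp_def by (blast intro: subspace_diff)+
  then have "p - a \<in> A \<inter> B" by simp
  then show "p = a"
    using assms(1) unfolding direct_sum_decomp_def by auto
qed (use assms in simp)

text \<open>
  The norm of \<open>\<Sum>\<^sub>j c\<^sub>j Y\<^sub>j(p)\<close> is a continuous function of \<open>(p, c)\<close> that does not vanish on
  \<open>K\<close> times the unit sphere, hence is bounded below there; homogeneity in \<open>c\<close> does the rest.
\<close>
lemma frame_coordinates_bounded:
  fixes Y :: "'i::finite \<Rightarrow> 'a::euclidean_space \<Rightarrow> 'b::real_normed_vector"
  assumes K: "compact K"
    and cont: "\<And>j. continuous_on K (Y j)"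
    and inj: "\<And>p. p \<in> K \<Longrightarrow> inj (\<lambda>c::real^'i. \<Sum>j\<in>UNIV. c $ j *\<^sub>R Y j p)"
  shows "\<exists>m>0. \<forall>p\<in>K. \<forall>c::real^'i. m * norm c \<le> norm (\<Sum>j\<in>UNIV. c $ j *\<^sub>R Y j p)"
proof (cases "K = {}")
  case True
  then show ?thesis by (auto intro: exI[of _ 1])
next
  case False
  let ?A = "\<lambda>p (c::real^'i). \<Sum>j\<in>UNIV. c $ j *\<^sub>R Y j p"
  let ?S = "sphere (0::real^'i) 1"
  have "?S \<noteq> {}" by simp
  have cont': "continuous_on (K \<times> ?S) (\<lambda>z. norm (?A (fst z) (snd z)))"
    by (intro continuous_intros continuous_on_compose2[OF cont]) auto
  obtain z0 where z0: "z0 \<in> K \<times> ?S"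
    "\<And>z. z \<in> K \<times> ?S \<Longrightarrow> norm (?A (fst z0) (snd z0)) \<le> norm (?A (fst z) (snd z))"
    using continuous_attains_inf[OF compact_Times[OF K compact_sphere] _ cont'] False \<open>?S \<noteq> {}\<close>
    by blast
  define m where "m = norm (?A (fst z0) (snd z0))"
  have "m > 0"
  proof (rule ccontr)
    assume "\<not> m > 0"
    then have "?A (fst z0) (snd z0) = ?A (fst z0) 0" by (simp add: m_def)
    then have "snd z0 = 0" using injD[OF inj[of "fst z0"]] z0(1) by auto
    then show False using z0(1) by auto
  qed
  moreover have "m * norm c \<le> norm (?A p c)" if "p \<in> K" for p c
  proof (cases "c = 0")
    case False
    have "?A p (c /\<^sub>R norm c) = ?A p c /\<^sub>R norm c"
      by (simp add: scaleR_sum_right)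
    moreover have "m \<le> norm (?A p (c /\<^sub>R norm c))"
      using z0(2)[of "(p, c /\<^sub>R norm c)"] that False by (simp add: m_def)
    ultimately show ?thesis using False by (simp add: field_simps)
  qed simp
  ultimately show ?thesis by blast
qed

lemma span_image_eq_coordinates:
  fixes Y :: "'i::finite \<Rightarrow> 'a::real_vector"
  assumes "v \<in> span (Y ` J)"
  shows "\<exists>c::real^'i. v = (\<Sum>j\<in>J. c $ j *\<^sub>R Y j)"
  using assms
proof (induction rule: span_induct_alt)
  case base
  show ?case by (rule exI[of _ 0]) simp
next
  case (step r z w)
  then obtain i and c :: "real^'i"
    where i: "i \<in> J" "z = Y i" and w: "w = (\<Sum>j\<in>J. c $ j *\<^sub>R Y j)"
    by blast
  let ?d = "\<chi> j. c $ j + (if j = i then r else 0)"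
  have "r *\<^sub>R z + w = (\<Sum>j\<in>J. ?d $ j *\<^sub>R Y j)"
    using i w
    by (simp add: scaleR_add_left sum.distrib if_distrib[of "\<lambda>r. r *\<^sub>R _"] cong: if_cong)
  then show ?case by (rule exI[of _ ?d])
qed

text \<open>
  In the coordinates \<open>c\<close> of \<open>v\<close> in the frame \<open>Y\<close>, the projection just drops the terms with index
  outside \<open>J\<close>. The frame has as many members as the dimension, so spanning makes the coordinate
  map injective.
\<close>
lemma frame_projection_bounded:
  fixes Y :: "'n::finite \<Rightarrow> real^'n \<Rightarrow> real^'n"
  assumes K: "compact K"
    and cont: "\<And>j. continuous_on UNIV (Y j)"
    and V: "\<And>p. V p = span ((\<lambda>j. Y j p) ` J)"
    and W: "\<And>p. W p = span ((\<lambda>j. Y j p) ` (- J))"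
    and dec: "\<And>p. direct_sum_decomp (V p) (W p)"
  shows "\<exists>B\<ge>0. \<forall>p\<in>K. \<forall>v. norm (proj_along (V p) (W p) v) \<le> B * norm v"
proof -
  let ?A = "\<lambda>p (c::real^'n). \<Sum>j\<in>UNIV. c $ j *\<^sub>R Y j p"
  have coords: "\<exists>c. v = ?A p c \<and> proj_along (V p) (W p) v = (\<Sum>j\<in>J. c $ j *\<^sub>R Y j p)" for p v
  proof -
    obtain a b where ab: "a \<in> V p" "b \<in> W p" "v = a + b"
      using dec[of p] unfolding direct_sum_decomp_def by blast
    obtain c where c: "a = (\<Sum>j\<in>J. c $ j *\<^sub>R Y j p)"
      using span_image_eq_coordinates ab(1) unfolding V by blast
    obtain d where d: "b = (\<Sum>j\<in>-J. d $ j *\<^sub>R Y j p)"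
      using span_image_eq_coordinates ab(2) unfolding W by blast
    let ?e = "\<chi> j. if j \<in> J then c $ j else d $ j"
    have "?A p ?e = (\<Sum>j\<in>J. ?e $ j *\<^sub>R Y j p) + (\<Sum>j\<in>-J. ?e $ j *\<^sub>R Y j p)"
      by (subst sum.union_disjoint[symmetric]) auto
    also have "\<dots> = v" unfolding ab(3) c d by simp
    finally have "v = ?A p ?e" by simp
    moreover have "proj_along (V p) (W p) v = (\<Sum>j\<in>J. ?e $ j *\<^sub>R Y j p)"
      using proj_along_eqI[OF dec ab(1), of v] ab(2,3) c by simp
    ultimately show ?thesis by blast
  qed
  have inj: "inj (?A p)" for p
  proof (rule linear_surjective_imp_injective)
    show "linear (?A p)"
      by (rule linearI) (simp_all add: scaleR_add_left sum.distrib scaleR_sum_right)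
    show "surj (?A p)" unfolding surj_def using coords[of _ p] by fast
  qed simp
  obtain m where m: "m > 0" "\<forall>p\<in>K. \<forall>c. m * norm c \<le> norm (?A p c)"
    using frame_coordinates_bounded[OF K continuous_on_subset[OF cont subset_UNIV] inj]
    by (elim exE conjE)
  have "\<exists>M. \<forall>p\<in>K. norm (Y j p) \<le> M" for j
    using compact_imp_bounded[OF compact_continuous_image[OF continuous_on_subset[OF cont subset_UNIV] K]]
    unfolding bounded_iff by blast
  then obtain M where M: "\<And>j p. p \<in> K \<Longrightarrow> norm (Y j p) \<le> M j" by metis
  let ?B = "(\<Sum>j\<in>J. \<bar>M j\<bar>) / m"
  have "norm (proj_along (V p) (W p) v) \<le> ?B * norm v" if p: "p \<in> K" for p v
  proof -
    obtain c where c: "v = ?A p c" "proj_along (V p) (W p) v = (\<Sum>j\<in>J. c $ j *\<^sub>R Y j p)"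
      using coords by blast
    have "norm c \<le> norm v / m"
      using bspec[OF m(2) p, THEN spec, of c] m(1) c(1) by (simp add: field_simps)
    then have c_le: "\<bar>c $ j\<bar> \<le> norm v / m" for j
      using component_le_norm_cart[of c j] by linarith
    have "norm (\<Sum>j\<in>J. c $ j *\<^sub>R Y j p) \<le> (\<Sum>j\<in>J. norm v / m * \<bar>M j\<bar>)"
    proof (rule sum_norm_le)
      fix j
      show "norm (c $ j *\<^sub>R Y j p) \<le> norm v / m * \<bar>M j\<bar>"
        unfolding norm_scaleR
        using c_le[of j] M[OF p, of j] m(1) by (intro mult_mono) auto
    qed
    also have "\<dots> = ?B * norm v"
      unfolding sum_distrib_left[symmetric] by simp
    finally show ?thesis unfolding c(2) .
  qed
  moreover have "?B \<ge> 0" using m(1) by (simp add: sum_nonneg)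
  ultimately show ?thesis by blast
qed

lemma smooth_map_continuous: "smooth_map f \<Longrightarrow> continuous_on UNIV f"
  unfolding smooth_map_def using Ck_map.simps(1) by blast

theorem proposition5p2p9:
  fixes V W :: "real ^ 'n \<Rightarrow> (real ^ 'n) set"
    and X :: "nat \<Rightarrow> real ^ 'n \<Rightarrow> real ^ 'n"
    and k :: nat
    and \<eta>0 :: real
    and x y :: "real ^ 'n"
  assumes "k \<le> CARD('n)"
    and "plane_distribution k V"
    and "plane_distribution (CARD('n) - k) W"
    and "\<And>i. i \<in> {1..CARD('n)} \<Longrightarrow> smooth_map (X i)"
    and "\<And>p. V p = span ((\<lambda>i. X i p) ` {1..k})"
    and "\<And>p. W p = span ((\<lambda>i. X i p) ` {k+1..CARD('n)})"
    and "\<And>p. direct_sum_decomp (V p) (W p)"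
    and "\<eta>0 \<in> {1..2}"
  shows "((\<lambda>\<eta>. dist_V V W \<eta> x y) \<longlongrightarrow> dist_V V W \<eta>0 x y) (at \<eta>0 within {1..2})"
proof -
  \<comment> \<open>Coordinates live in \<open>real ^ 'n\<close>, so the fields are numbered by \<open>'n\<close>.\<close>
  obtain f :: "'n \<Rightarrow> nat" where f: "bij_betw f UNIV {1..CARD('n)}"
    using finite_same_card_bij[of "UNIV :: 'n set" "{1..CARD('n)}"] by auto
  have f_range: "range f = {1..CARD('n)}"
    using f by (simp add: bij_betw_def)
  define J where "J = f -` {1..k}"
  have J: "f ` J = {1..k}"
    unfolding J_def image_vimage_eq f_range using assms(1) by auto
  have "- J = f -` {k+1..CARD('n)}"
    using f_range by (force simp: J_def)
  then have J': "f ` (- J) = {k+1..CARD('n)}"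
    by (simp only: image_vimage_eq f_range) auto
  interpret locally_bounded_splitting V W
  proof
    fix K :: "(real ^ 'n) set" assume "compact K"
    then show "\<exists>B\<ge>0. \<forall>p\<in>K. \<forall>v. norm (proj_along (V p) (W p) v) \<le> B * norm v"
    proof (rule frame_projection_bounded[where Y = "\<lambda>j. X (f j)" and J = J])
      show "continuous_on UNIV (X (f j))" for j
        using assms(4) f_range by (blast intro: smooth_map_continuous)
      show "V p = span ((\<lambda>j. X (f j) p) ` J)" for p
        unfolding assms(5) J[symmetric] by (simp add: image_image)
      show "W p = span ((\<lambda>j. X (f j) p) ` (- J))" for p
        unfolding assms(6) J'[symmetric] by (simp add: image_image)
    qed (rule assms(7))
  qed
  show ?thesis by (rule dist_V_tendsto[OF assms(8)])
qed

end
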